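(* Let $G$ be a non-trivial quasi-tree, that is, a connected graph which is not a tree but which contains a vertex $x\in V(G)$ such that $G-x$ is a tree. Then $\gamma_t(G)\leq a(G)+1$.
   Context: All graphs are finite and simple. $m(G)$ denotes the number of edges of $G$. A total dominating set of $G$ is a set $D\subseteq V(G)$ such that every vertex of $V(G)$ has a neighbor in $D$; the total domination number $\gamma_t(G)$ is the minimum cardinality of a total dominating set of $G$. If $d_1\leq d_2\leq\cdots\leq d_n$ is the ordered degree sequence of $G$, the annihilation number $a(G)$ is the largest integer $k$ with $k\le n$ such that $\sum_{i=1}^{k} d_i\leq m(G)$. A quasi-tree is a connected graph $G$ with a vertex $x$ such that $G-x$ is a tree; it is non-trivial if $G$ itself is not a tree. *)

theory Defs
  imports
    "Graph_Theory.Digraph_Component"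
    "HOL-Library.Multiset"
begin

text \<open>
  A finite simple graph is modelled, as in Graph_Theory, by the locale \<^locale>\<open>graph\<close>: a finite
  symmetric digraph without loops and parallel arcs. An undirected edge is thus a pair of opposite
  arcs, \<^term>\<open>arcs_ends G\<close> is the adjacency relation, and the degree of a vertex is its
  \<^const>\<open>out_degree\<close>.
\<close>

definition edges :: "('a, 'b) pre_digraph \<Rightarrow> 'a set set" where
  "edges G = (\<lambda>e. {tail G e, head G e}) ` arcs G"

text \<open>
  The constants \<^const>\<open>forest\<close> and \<^const>\<open>tree\<close> of Graph_Theory are not usable here: in a
  symmetric digraph every edge yields a directed cycle of length 2. The cycles of the undirected
  graph are the directed cycles of length at least 3.
\<close>

definition undirected_cycle :: "('a, 'b) pre_digraph \<Rightarrow> 'b awalk \<Rightarrow> bool" where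
  "undirected_cycle G p \<longleftrightarrow> pre_digraph.cycle G p \<and> 3 \<le> length p"

definition undirected_tree :: "('a, 'b) pre_digraph \<Rightarrow> bool" where
  "undirected_tree G \<longleftrightarrow> connected G \<and> (\<nexists>p. undirected_cycle G p)"

definition quasi_tree :: "('a, 'b) pre_digraph \<Rightarrow> bool" where
  "quasi_tree G \<longleftrightarrow>
     connected G \<and> (\<exists>x \<in> verts G. undirected_tree (pre_digraph.del_vert G x))"

definition nontrivial_quasi_tree :: "('a, 'b) pre_digraph \<Rightarrow> bool" where
  "nontrivial_quasi_tree G \<longleftrightarrow> quasi_tree G \<and> \<not> undirected_tree G"

definition total_dominating_set :: "('a, 'b) pre_digraph \<Rightarrow> 'a set \<Rightarrow> bool" where
  "total_dominating_set G D \<longleftrightarrow>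
     D \<subseteq> verts G \<and> (\<forall>v \<in> verts G. \<exists>u \<in> D. v \<rightarrow>\<^bsub>G\<^esub> u)"

text \<open>Only meaningful for graphs without isolated vertices, where a total dominating set exists.\<close>

definition total_domination_number :: "('a, 'b) pre_digraph \<Rightarrow> nat" where
  "total_domination_number G = (LEAST k. \<exists>D. total_dominating_set G D \<and> card D = k)"

definition degree_sequence :: "('a, 'b) pre_digraph \<Rightarrow> nat list" where
  "degree_sequence G = sorted_list_of_multiset (image_mset (out_degree G) (mset_set (verts G)))"

definition annihilation_number :: "('a, 'b) pre_digraph \<Rightarrow> nat" where
  "annihilation_number G =
     (GREATEST k. k \<le> card (verts G) \<and> sum_list (take k (degree_sequence G)) \<le> card (edges G))"

end

theory Submission
  imports Defs
begin

text \<open>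
  Let \<open>G - x\<close> be a tree. Root it at a neighbour of \<open>x\<close> and hang this neighbour below \<open>x\<close>: the
  result is a spanning tree of \<open>G\<close> with root \<open>x\<close>, and every other edge of \<open>G\<close> ends in \<open>x\<close>. Hence
  the degree of a vertex \<open>v \<noteq> x\<close> is its number of children plus 1, or plus 2 if \<open>v\<close> is joined to
  \<open>x\<close> by a non-tree edge, and the number of edges is \<open>m = n - 1 + d\<close>, where \<open>d\<close> counts the non-tree
  edges.

  Total domination enters only through three bounds that hold for every rooted spanning tree with at
  least two vertices. If \<open>C\<close> is the set of childless vertices, then
  \<open>\<gamma>\<^sub>t \<le> n - card C + 1\<close>, \<open>2 \<gamma>\<^sub>t \<le> n + card C + 1\<close> and \<open>3 \<gamma>\<^sub>t \<le> 2 n + 2\<close>. The first is witnessed by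
  the vertices with children and one child of the root, the other two by taking two consecutive depths
  out of every four, or out of every three, repairing the set at childless vertices and at the root,
  and averaging over the offset.

  On the other side, \<open>a(G) \<ge> card S\<close> for every vertex set \<open>S\<close> of degree sum at most \<open>m\<close>. Fill \<open>S\<close>
  greedily with vertices other than \<open>x\<close>: those of degree 1, then those of degree 2, then those of
  degree 3 that have exactly one child. If the budget \<open>m\<close> ends among the vertices of degree 2, then
  \<open>a(G) + 1 \<ge> (m + l + 2) div 2\<close> with \<open>l\<close> vertices of degree 1; as \<open>card C \<le> l + d\<close>, the second bound
  suffices. If it ends among the vertices of degree 3, the third bound suffices, and if it covers all
  of them, the first. The last two comparisons rest on the fact that a rooted tree has more childless
  vertices than vertices with two or more children.
\<close>

section \<open>Small vertex sets and the annihilation number\<close>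

text \<open>
  Remove the head of \<open>xs\<close> together with one element of \<open>M\<close>: the head itself if it occurs in \<open>M\<close>, and
  otherwise any element, which is at least as large. The rest of \<open>M\<close> lies in the tail of \<open>xs\<close>.
\<close>

lemma sum_list_take_le_sum_mset:
  fixes xs :: "nat list"
  assumes "sorted xs" "M \<subseteq># mset xs"
  shows "sum_list (take (size M) xs) \<le> sum_mset M"
  using assms
proof (induction xs arbitrary: M)
  case Nil
  then show ?case by simp
next
  case (Cons a xs)
  show ?case
  proof (cases "M = {#}")
    case False
    obtain b where b: "b \<in># M" "a \<in># M \<longrightarrow> b = a"
      using False by auto
    have sub: "M - {#b#} \<subseteq># mset xs"
    proof (cases "a \<in># M")
      case True
      with b Cons.prems(2) show ?thesis
        by (simp add: subset_eq_diff_conv)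
    next
      case False
      with Cons.prems(2) have "M \<subseteq># mset xs"
        by (metis diff_single_trivial mset.simps(2) subset_eq_diff_conv add_mset_add_single)
      then show ?thesis
        by (meson diff_subset_eq_self subset_mset.order_trans)
    qed
    have M: "M = add_mset b (M - {#b#})"
      using b by simp
    have "a \<le> b"
      using Cons.prems b by (auto dest!: mset_subset_eqD)
    moreover have "sum_list (take (size (M - {#b#})) xs) \<le> sum_mset (M - {#b#})"
      using Cons.IH[OF _ sub] Cons.prems(1) by simp
    moreover have "size M = Suc (size (M - {#b#}))" "sum_mset M = b + sum_mset (M - {#b#})"
      by (subst M, simp)+
    ultimately show ?thesis by simp
  qed simp
qed

text \<open>
  The vertices of \<open>S\<close> need not have the smallest degrees, so a lower bound on the annihilation number
  only asks for a convenient set.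
\<close>

lemma card_le_annihilation_number:
  assumes fin: "finite (verts G)" and S: "S \<subseteq> verts G"
    and le: "(\<Sum>v\<in>S. out_degree G v) \<le> card (edges G)"
  shows "card S \<le> annihilation_number G"
proof -
  let ?M = "image_mset (out_degree G) (mset_set S)"
  have "?M \<subseteq># mset (degree_sequence G)"
    unfolding degree_sequence_def
    using S fin by (auto intro!: image_mset_subseteq_mono simp: finite_subset)
  then have "sum_list (take (size ?M) (degree_sequence G)) \<le> sum_mset ?M"
    by (intro sum_list_take_le_sum_mset) (simp_all add: degree_sequence_def)
  also have "sum_mset ?M = (\<Sum>v\<in>S. out_degree G v)"
    by (simp add: sum_unfold_sum_mset)
  finally have "sum_list (take (card S) (degree_sequence G)) \<le> card (edges G)"
    using le by simp
  moreover have "card S \<le> card (verts G)"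
    using S fin by (rule card_mono[rotated])
  ultimately show ?thesis
    unfolding annihilation_number_def
    by (intro Greatest_le_nat[where b = "card (verts G)"]) auto
qed

lemma total_domination_number_le_card:
  assumes "total_dominating_set G D"
  shows "total_domination_number G \<le> card D"
  unfolding total_domination_number_def using assms by (blast intro: Least_le)

section \<open>Total dominating sets from a rooted spanning tree\<close>

lemma sum_card_residue_classes:
  assumes "finite A" "0 < (k::nat)"
  shows "(\<Sum>j<k. card {v \<in> A. f v mod k = j}) = card A"
proof -
  have "card A = (\<Sum>v\<in>A. \<Sum>j<k. if f v mod k = j then 1 else 0)"
    using assms by simp
  also have "\<dots> = (\<Sum>j<k. \<Sum>v\<in>A. if f v mod k = j then 1 else 0)"
    by (rule sum.swap)
  also have "\<dots> = (\<Sum>j<k. card {v \<in> A. f v mod k = j})"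
    using assms by (simp add: sum.If_cases Int_def)
  finally show ?thesis by simp
qed

text \<open>
  The next three lemmas are the residue arithmetic of the depth classes. Let \<open>j\<close> and \<open>j + 1\<close> be the
  classes chosen modulo 4 or 3, and let \<open>d\<close> be the depth of a parent and \<open>Suc d\<close> that of its child. In
  the lemmas named after vertex or parent, the child is the vertex to be dominated: either its parent
  is chosen, or it lies in a class that must look downwards, where its own children are chosen.
\<close>

lemma mod_4_vertex_or_parent:
  assumes "(j::nat) < 4"
  shows "(d mod 4 = j \<or> d mod 4 = Suc j mod 4) \<or> (Suc d mod 4 = j \<or> Suc d mod 4 = (j + 3) mod 4)"
proof -
  have "j = 0 \<or> j = 1 \<or> j = 2 \<or> j = 3"
    using assms by arith
  then show ?thesis
    by (elim disjE; simp; presburger)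
qed

lemma mod_4_child:
  assumes "(j::nat) < 4" "d mod 4 = j \<or> d mod 4 = (j + 3) mod 4"
  shows "Suc d mod 4 = j \<or> Suc d mod 4 = Suc j mod 4"
proof -
  have "j = 0 \<or> j = 1 \<or> j = 2 \<or> j = 3"
    using assms(1) by arith
  then show ?thesis
    using assms(2) by (elim disjE) (simp_all add: mod_Suc)
qed

lemma mod_3_vertex_or_parent:
  assumes "(j::nat) < 3"
  shows "d mod 3 = Suc j mod 3 \<or> d mod 3 = j \<or> Suc d mod 3 = j"
proof -
  have "j = 0 \<or> j = 1 \<or> j = 2"
    using assms by arith
  then show ?thesis
    by (elim disjE; simp; presburger)
qed

text \<open>
  The spanning tree is given by a parent function; the depth serves as a certificate that iterating it
  reaches \<open>r\<close> without running into a cycle.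
\<close>

locale rooted_spanning_tree = graph +
  fixes r :: 'a and par :: "'a \<Rightarrow> 'a" and dep :: "'a \<Rightarrow> nat"
  assumes root_in_verts: "r \<in> verts G"
    and dep_root: "dep r = 0"
    and par_in_verts: "v \<in> verts G \<Longrightarrow> v \<noteq> r \<Longrightarrow> par v \<in> verts G"
    and adj_par: "v \<in> verts G \<Longrightarrow> v \<noteq> r \<Longrightarrow> v \<rightarrow> par v"
    and dep_par: "v \<in> verts G \<Longrightarrow> v \<noteq> r \<Longrightarrow> dep v = Suc (dep (par v))"
    and root_has_child: "\<exists>c \<in> verts G - {r}. par c = r"
begin

definition children :: "'a \<Rightarrow> 'a set" where
  "children v = {u \<in> verts G - {r}. par u = v}"

definition childless :: "'a set" where
  "childless = {v \<in> verts G. children v = {}}"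

lemma finite_children [simp]: "finite (children v)"
  unfolding children_def by simp

lemma finite_childless [simp]: "finite childless"
  unfolding childless_def by simp

lemma root_not_childless: "r \<notin> childless"
  using root_has_child by (auto simp: childless_def children_def)

lemma adj_sym: "u \<rightarrow> v \<Longrightarrow> v \<rightarrow> u"
  using sym_arcs by (rule arcs_ends_symmetric)

lemma total_dominating_setI_tree:
  assumes "D \<subseteq> verts G" "c \<in> D" "c \<noteq> r" "par c = r"
    and "\<And>v. v \<in> verts G \<Longrightarrow> v \<noteq> r \<Longrightarrow> par v \<in> D \<or> (\<exists>u \<in> children v. u \<in> D)"
  shows "total_dominating_set G D"
  unfolding total_dominating_set_def
proof (intro conjI ballI)
  fix v assume v: "v \<in> verts G"
  show "\<exists>u\<in>D. v \<rightarrow> u"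
  proof (cases "v = r")
    case True
    with assms show ?thesis using adj_par adj_sym by blast
  next
    case False
    with v assms(5) show ?thesis
      using adj_par adj_sym by (fastforce simp: children_def)
  qed
qed fact

text \<open>Parents always have children, so only the root still needs a neighbour in the set.\<close>

lemma total_dominating_set_nonchildless:
  obtains D where "total_dominating_set G D" "card D + card childless \<le> card (verts G) + 1"
proof -
  obtain c where c: "c \<in> verts G" "c \<noteq> r" "par c = r"
    using root_has_child by auto
  define D where "D = insert c (verts G - childless)"
  have "total_dominating_set G D"
  proof (rule total_dominating_setI_tree[of _ c])
    fix v assume "v \<in> verts G" "v \<noteq> r"
    then show "par v \<in> D \<or> (\<exists>u\<in>children v. u \<in> D)"
      using par_in_verts by (auto simp: D_def childless_def children_def)
  qed (use c in \<open>auto simp: D_def\<close>)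
  moreover have "card D \<le> Suc (card (verts G - childless))"
    unfolding D_def by (rule card_insert_le_m1) (auto)
  moreover have "card (verts G - childless) + card childless = card (verts G)"
    by (subst card_Un_disjoint[symmetric]) (auto simp: childless_def intro: arg_cong[where f = card])
  ultimately show ?thesis using that by fastforce
qed

text \<open>
  Take all vertices whose depth is \<open>j\<close> or \<open>j + 1\<close> modulo 4. A vertex of depth \<open>j + 1\<close> or \<open>j + 2\<close> sees its
  parent, and one of depth \<open>j\<close> or \<open>j + 3\<close> sees a child unless it is childless; in that case its parent
  is added. The root has no parent and needs a child to be added for \<open>j = 2\<close> and \<open>j = 3\<close>. Over the four
  values of \<open>j\<close>, every vertex is counted twice and each childless vertex, as well as the root, causes
  two additions, so the average size is \<open>(2 n + 2 card C + 2) / 4\<close>.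
\<close>

lemma total_dominating_set_mod_4:
  obtains D where "total_dominating_set G D" "2 * card D \<le> card (verts G) + card childless + 1"
proof -
  obtain c where c: "c \<in> verts G" "c \<noteq> r" "par c = r"
    using root_has_child by auto
  have dep_c: "dep c = 1"
    using c dep_par dep_root by simp
  define X where "X j = {v \<in> verts G. dep v mod 4 = j}" for j
  define Y where "Y j = {v \<in> childless. dep v mod 4 = j}" for j
  define D where "D j = X j \<union> X (Suc j mod 4) \<union> par ` (Y j \<union> Y ((j + 3) mod 4))
    \<union> (if j < 2 then {} else {c})" for j
  have fin: "finite (X j)" "finite (Y j)" for j
    by (auto simp: X_def Y_def)
  have dom: "total_dominating_set G (D j)" if j: "j < 4" for j
  proof (rule total_dominating_setI_tree[of _ c])
    show "D j \<subseteq> verts G"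
      using c root_not_childless
      by (auto simp: D_def X_def Y_def childless_def intro!: par_in_verts)
    show "c \<in> D j"
      using j c dep_c by (auto simp: D_def X_def)
    fix v assume v: "v \<in> verts G" "v \<noteq> r"
    have "(dep (par v) mod 4 = j \<or> dep (par v) mod 4 = Suc j mod 4)
        \<or> (dep v mod 4 = j \<or> dep v mod 4 = (j + 3) mod 4)"
      using mod_4_vertex_or_parent[OF j] dep_par[OF v] by metis
    then consider "dep (par v) mod 4 = j \<or> dep (par v) mod 4 = Suc j mod 4"
      | "dep v mod 4 = j \<or> dep v mod 4 = (j + 3) mod 4"
      by blast
    then show "par v \<in> D j \<or> (\<exists>u\<in>children v. u \<in> D j)"
    proof cases
      case 1
      then show ?thesis using par_in_verts[OF v] by (auto simp: D_def X_def)
    next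
      case 2
      show ?thesis
      proof (cases "v \<in> childless")
        case True
        then show ?thesis using 2 by (auto simp: D_def Y_def)
      next
        case False
        then obtain u where u: "u \<in> children v"
          using v by (auto simp: childless_def)
        then have "dep u = Suc (dep v)" "u \<in> verts G"
          using dep_par by (auto simp: children_def)
        moreover from this have "dep u mod 4 = j \<or> dep u mod 4 = Suc j mod 4"
          using mod_4_child[OF j 2] by simp
        ultimately have "u \<in> D j"
          by (auto simp: D_def X_def)
        with u show ?thesis by blast
      qed
    qed
  qed (use c in auto)
  have card_D: "card (D j) \<le> card (X j) + card (X (Suc j mod 4)) + (card (Y j) + card (Y ((j + 3) mod 4)))
    + (if j < 2 then 0 else 1)" for j
  proof -
    have "card (par ` (Y j \<union> Y ((j + 3) mod 4))) \<le> card (Y j) + card (Y ((j + 3) mod 4))"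
      using card_image_le card_Un_le fin by (meson finite_UnI order_trans)
    then show ?thesis
      unfolding D_def
      by (intro order_trans[OF card_Un_le] add_mono) auto
  qed
  have "(\<Sum>j<4. card (X j)) = card (verts G)" "(\<Sum>j<4. card (Y j)) = card childless"
    unfolding X_def Y_def by (simp_all add: sum_card_residue_classes)
  then have sums: "card (X 0) + card (X 1) + card (X 2) + card (X 3) = card (verts G)"
      "card (Y 0) + card (Y 1) + card (Y 2) + card (Y 3) = card childless"
    by (simp_all add: eval_nat_numeral)
  have "\<exists>j<4. 2 * card (D j) \<le> card (verts G) + card childless + 1"
  proof (rule ccontr)
    assume "\<not> ?thesis"
    then have "2 * card (D j) > card (verts G) + card childless + 1" if "j < 4" for j
      using that by (meson not_le)
    from this[of 0] this[of 1] this[of 2] this[of 3]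
    have "2 * card (verts G) + 2 * card childless + 2
        < card (D 0) + card (D 1) + card (D 2) + card (D 3)"
      by linarith
    moreover have "card (D 0) \<le> card (X 0) + card (X 1) + (card (Y 0) + card (Y 3))"
      "card (D 1) \<le> card (X 1) + card (X 2) + (card (Y 1) + card (Y 0))"
      "card (D 2) \<le> card (X 2) + card (X 3) + (card (Y 2) + card (Y 1)) + 1"
      "card (D 3) \<le> card (X 3) + card (X 0) + (card (Y 3) + card (Y 2)) + 1"
      using card_D[of 0] card_D[of 1] card_D[of 2] card_D[of 3]
      by (simp_all flip: numeral_2_eq_2)
    ultimately show False
      using sums by linarith
  qed
  then show ?thesis using dom that by blast
qed

text \<open>
  Take all vertices whose depth is \<open>j\<close> or \<open>j + 1\<close> modulo 3. Now the parent of a vertex of depth \<open>j\<close> has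
  depth \<open>j + 2\<close>, and its own parent is in the set. A childless vertex of depth \<open>j\<close> can therefore be
  exchanged for its parent, since no other vertex of the tree relies on it, and the repair is free. Only the root
  costs one more vertex for \<open>j = 1\<close> and \<open>j = 2\<close>, so the three sizes add up to at most \<open>2 n + 2\<close>.
\<close>

lemma total_dominating_set_mod_3:
  obtains D where "total_dominating_set G D" "3 * card D \<le> 2 * card (verts G) + 2"
proof -
  obtain c where c: "c \<in> verts G" "c \<noteq> r" "par c = r"
    using root_has_child by auto
  have dep_c: "dep c = 1"
    using c dep_par dep_root by simp
  define X where "X j = {v \<in> verts G. dep v mod 3 = j}" for j
  define D where "D j = (X j - childless) \<union> par ` (X j \<inter> childless) \<union> X (Suc j mod 3)
    \<union> (if j = 0 then {} else {c})" for j
  have fin: "finite (X j)" for j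
    by (auto simp: X_def)
  have dom: "total_dominating_set G (D j)" if j: "j < 3" for j
  proof (rule total_dominating_setI_tree[of _ c])
    show "D j \<subseteq> verts G"
      using c root_not_childless
      by (auto simp: D_def X_def childless_def intro!: par_in_verts)
    show "c \<in> D j"
      using j c dep_c by (auto simp: D_def X_def)
    fix v assume v: "v \<in> verts G" "v \<noteq> r"
    have "dep (par v) mod 3 = Suc j mod 3 \<or> dep (par v) mod 3 = j \<or> dep v mod 3 = j"
      using mod_3_vertex_or_parent[OF j] dep_par[OF v] by metis
    then consider "dep (par v) mod 3 = Suc j mod 3" | "dep (par v) mod 3 = j" | "dep v mod 3 = j"
      by blast
    then show "par v \<in> D j \<or> (\<exists>u\<in>children v. u \<in> D j)"
    proof cases
      case 1
      then show ?thesis using par_in_verts[OF v] by (auto simp: D_def X_def)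
    next
      case 2
      moreover have "par v \<notin> childless"
        using v by (auto simp: childless_def children_def)
      ultimately show ?thesis using par_in_verts[OF v] by (auto simp: D_def X_def)
    next
      case 3
      show ?thesis
      proof (cases "v \<in> childless")
        case True
        then show ?thesis using 3 v by (auto simp: D_def X_def)
      next
        case False
        then obtain u where u: "u \<in> children v"
          using v by (auto simp: childless_def)
        then have "dep u = Suc (dep v)" "u \<in> verts G"
          using dep_par by (auto simp: children_def)
        moreover from this 3 have "dep u mod 3 = Suc j mod 3"
          by (auto simp: mod_Suc)
        ultimately have "u \<in> D j"
          by (auto simp: D_def X_def)
        with u show ?thesis by blast
      qed
    qed
  qed (use c in auto)
  have card_D: "card (D j) \<le> card (X j) + card (X (Suc j mod 3)) + (if j = 0 then 0 else 1)" for j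
  proof -
    have "card ((X j - childless) \<union> par ` (X j \<inter> childless))
      \<le> card (X j - childless) + card (X j \<inter> childless)"
      using card_Un_le card_image_le fin by (meson add_left_mono finite_Int order_trans)
    also have "\<dots> = card (X j)"
      using fin by (subst card_Un_disjoint[symmetric]) (auto intro: arg_cong[where f = card])
    finally have "card ((X j - childless) \<union> par ` (X j \<inter> childless)) \<le> card (X j)" .
    then have "card (D j) \<le> card (X j) + card (X (Suc j mod 3)) + card (if j = 0 then {} else {c})"
      unfolding D_def by (meson add_mono card_Un_le le_refl order_trans)
    then show ?thesis
      by (simp split: if_splits)
  qed
  have "(\<Sum>j<3. card (X j)) = card (verts G)"
    unfolding X_def by (simp add: sum_card_residue_classes)
  then have sums: "card (X 0) + card (X 1) + card (X 2) = card (verts G)"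
    by (simp add: eval_nat_numeral)
  have "\<exists>j<3. 3 * card (D j) \<le> 2 * card (verts G) + 2"
  proof (rule ccontr)
    assume "\<not> ?thesis"
    then have "3 * card (D j) > 2 * card (verts G) + 2" if "j < 3" for j
      using that by (meson not_le)
    from this[of 0] this[of 1] this[of 2]
    have "2 * card (verts G) + 2 < card (D 0) + card (D 1) + card (D 2)"
      by linarith
    moreover have "card (D 0) \<le> card (X 0) + card (X 1)" "card (D 1) \<le> card (X 1) + card (X 2) + 1"
      "card (D 2) \<le> card (X 2) + card (X 0) + 1"
      using card_D[of 0] card_D[of 1] card_D[of 2] by (simp_all flip: numeral_2_eq_2)
    ultimately show False
      using sums by linarith
  qed
  then show ?thesis using dom that by blast
qed

end

section \<open>Vertices and edges over a tree with one apex\<close>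

text \<open>
  A graph that becomes a tree when the apex \<open>r\<close> is deleted, presented by a spanning tree in which the
  apex is the root.
\<close>

locale apex_tree = rooted_spanning_tree +
  assumes nontree_at_root: "u \<rightarrow> v \<Longrightarrow> u \<noteq> r \<Longrightarrow> v \<noteq> r \<Longrightarrow> par u = v \<or> par v = u"
begin

text \<open>The neighbours of the apex along non-tree edges; its children are left out.\<close>

definition apex_neighbours :: "'a set" where
  "apex_neighbours = {v \<in> verts G - {r}. v \<rightarrow> r \<and> par v \<noteq> r}"

lemma card_edges_ge: "card (verts G - {r}) + card apex_neighbours \<le> card (edges G)"
proof -
  have edgeI: "{u, v} \<in> edges G" if "u \<rightarrow> v" for u v
    using that by (auto simp: edges_def arcs_ends_conv)
  let ?T = "(\<lambda>v. {v, par v}) ` (verts G - {r})" and ?A = "(\<lambda>v. {v, r}) ` apex_neighbours"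
  have par_neq: "v \<noteq> par v \<and> dep v = Suc (dep (par v))" if "v \<in> verts G" "v \<noteq> r" for v
    using dep_par[OF that] by auto
  have "inj_on (\<lambda>v. {v, par v}) (verts G - {r})"
  proof (rule inj_onI)
    fix u v assume uv: "u \<in> verts G - {r}" "v \<in> verts G - {r}" "{u, par u} = {v, par v}"
    show "u = v"
    proof (rule ccontr)
      assume "u \<noteq> v"
      with uv(3) have "par v = u" "par u = v"
        by (auto simp: doubleton_eq_iff)
      then have "dep u = Suc (dep v)" "dep v = Suc (dep u)"
        using uv(1,2) dep_par[of u] dep_par[of v] by simp_all
      then show False by simp
    qed
  qed
  then have card_T: "card ?T = card (verts G - {r})"
    by (rule card_image)
  have "inj_on (\<lambda>v. {v, r}) apex_neighbours"
    by (auto simp: inj_on_def doubleton_eq_iff apex_neighbours_def)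
  then have card_A: "card ?A = card apex_neighbours"
    by (rule card_image)
  have "?T \<inter> ?A = {}"
    by (auto simp: doubleton_eq_iff apex_neighbours_def)
  moreover have "finite ?T" "finite ?A"
    by (auto simp: apex_neighbours_def)
  ultimately have "card (?T \<union> ?A) = card (verts G - {r}) + card apex_neighbours"
    using card_T card_A by (simp add: card_Un_disjoint)
  moreover have "?T \<union> ?A \<subseteq> edges G"
    using adj_par by (auto simp: apex_neighbours_def intro!: edgeI)
  moreover have "finite (edges G)"
    by (simp add: edges_def)
  ultimately show ?thesis
    using card_mono[of "edges G" "?T \<union> ?A"] by linarith
qed

lemma out_degree_le:
  assumes v: "v \<in> verts G" "v \<noteq> r"
  shows "out_degree G v \<le> card (children v) + 1 + (if v \<in> apex_neighbours then 1 else 0)"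
proof -
  let ?N = "children v \<union> {par v} \<union> (if v \<in> apex_neighbours then {r} else {})"
  have "head G ` out_arcs G v \<subseteq> ?N"
  proof
    fix u assume "u \<in> head G ` out_arcs G v"
    then have vu: "v \<rightarrow> u"
      by (auto simp: arcs_ends_conv)
    then have "u \<in> verts G"
      using adj_in_verts by blast
    then show "u \<in> ?N"
      using v vu nontree_at_root[OF vu] by (auto simp: children_def apex_neighbours_def)
  qed
  moreover have "inj_on (head G) (out_arcs G v)"
    by (auto simp: inj_on_def arc_to_ends_def intro!: no_multi_arcs)
  ultimately have "out_degree G v \<le> card ?N"
    unfolding out_degree_def by (intro card_inj_on_le) auto
  also have "\<dots> \<le> card (children v) + 1 + (if v \<in> apex_neighbours then 1 else 0)"
    by (intro order_trans[OF card_Un_le] add_mono) auto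
  finally show ?thesis .
qed

lemma sum_card_children: "(\<Sum>v\<in>verts G. card (children v)) = card (verts G - {r})"
proof -
  have "(\<Sum>v\<in>verts G. card (children v)) = card (\<Union>v\<in>verts G. children v)"
    by (rule card_UN_disjoint[symmetric]) (auto simp: children_def)
  also have "(\<Union>v\<in>verts G. children v) = verts G - {r}"
    using par_in_verts by (auto simp: children_def)
  finally show ?thesis .
qed

text \<open>
  The vertices other than the root fall into six classes: those with no child, one child, or at least
  two children (\<open>L\<close>, \<open>P\<close>, \<open>B\<close> for leaf, path and branching), primed if a non-tree edge joins them to the
  root. The vertices of \<open>L\<close> have degree 1, those of \<open>L'\<close> and \<open>P\<close> degree 2 and those of \<open>P'\<close> degree 3.
  Once the three domination bounds and the annihilation bound are expressed in the sizes of these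
  classes, only linear arithmetic over the integers is left.
\<close>

theorem total_domination_number_le_annihilation_number:
  "total_domination_number G \<le> annihilation_number G + 1"
proof -
  let ?g = "total_domination_number G" and ?a = "annihilation_number G"
  define W where "W = verts G - {r}"
  define c where "c v = card (children v)" for v
  let ?A = apex_neighbours
  define L where "L = {v \<in> W. c v = 0 \<and> v \<notin> ?A}"
  define L' where "L' = {v \<in> W. c v = 0 \<and> v \<in> ?A}"
  define P where "P = {v \<in> W. c v = 1 \<and> v \<notin> ?A}"
  define P' where "P' = {v \<in> W. c v = 1 \<and> v \<in> ?A}"
  define B where "B = {v \<in> W. 2 \<le> c v \<and> v \<notin> ?A}"
  define B' where "B' = {v \<in> W. 2 \<le> c v \<and> v \<in> ?A}"
  note defs = L_def L'_def P_def P'_def B_def B'_def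
  have fin [simp]: "finite W" "finite L" "finite L'" "finite P" "finite P'" "finite B" "finite B'"
    by (auto simp: defs W_def)
  have A_sub: "?A \<subseteq> W"
    by (auto simp: apex_neighbours_def W_def)
  have card_Un3: "card (X1 \<union> X2 \<union> X3) = card X1 + card X2 + card X3"
    if "finite X1" "finite X2" "finite X3" "X1 \<inter> X2 = {}" "X1 \<inter> X3 = {}" "X2 \<inter> X3 = {}"
    for X1 X2 X3 :: "'a set"
    using that by (simp add: card_Un_disjoint Int_Un_distrib2)
  have "?A = L' \<union> P' \<union> B'"
    using A_sub by (auto simp: defs)
  then have card_A: "card ?A = card L' + card P' + card B'"
    by (simp only:) (rule card_Un3; auto simp: defs)
  have "W - ?A = L \<union> P \<union> B"
    by (auto simp: defs)
  then have "card (W - ?A) = card L + card P + card B"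
    by (simp only:) (rule card_Un3; auto simp: defs)
  then have card_W: "card W = card L + card P + card B + (card L' + card P' + card B')"
    using card_A A_sub by (metis card_Diff_subset card_mono fin(1) finite_subset le_add_diff_inverse2)
  have card_V: "card (verts G) = card W + 1"
    unfolding W_def using root_in_verts by (metis Suc_eq_plus1 card.remove finite_verts)
  have "childless = L \<union> L'"
    using root_not_childless by (auto simp: defs childless_def W_def c_def)
  then have card_C: "card childless = card L + card L'"
    by (simp only:) (rule card_Un_disjoint; auto simp: defs)
  \<comment> \<open>Every vertex except the root is a child, and the root has a child too, so on average the
    vertices other than the root have less than one child.\<close>
  have leaves_ge: "card B + card B' + 1 \<le> card L + card L'"
  proof -
    have "1 \<le> c r"
      using root_has_child by (auto simp: c_def Suc_le_eq card_gt_0_iff children_def)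
    moreover have "(\<Sum>v\<in>verts G. c v) = c r + (\<Sum>v\<in>W. c v)"
      unfolding W_def using root_in_verts by (simp add: sum.remove)
    ultimately have "1 + (\<Sum>v\<in>W. c v) \<le> card W"
      using sum_card_children by (simp add: W_def c_def)
    moreover have "(\<Sum>v\<in>W. (if v \<in> P \<union> P' then 1 else 0) + (if v \<in> B \<union> B' then 2 else 0)) \<le> (\<Sum>v\<in>W. c v)"
      by (rule sum_mono) (auto simp: defs)
    moreover have "(\<Sum>v\<in>W. (if v \<in> P \<union> P' then 1 else 0) + (if v \<in> B \<union> B' then 2 else 0))
      = card (P \<union> P') + 2 * card (B \<union> B')"
    proof -
      have "W \<inter> (P \<union> P') = P \<union> P'" "W \<inter> (B \<union> B') = B \<union> B'"
        by (auto simp: defs)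
      then show ?thesis
        by (simp add: sum.distrib sum.If_cases flip: Un_iff)
    qed
    moreover have "card (P \<union> P') = card P + card P'" "card (B \<union> B') = card B + card B'"
      by (rule card_Un_disjoint; auto simp: defs)+
    ultimately show ?thesis
      using card_W by linarith
  qed
  \<comment> \<open>All of \<open>L\<close>, \<open>k\<close> further vertices of degree 2 and \<open>q\<close> of degree 3.\<close>
  have ann: "card L + k + q \<le> ?a"
    if k: "k \<le> card L' + card P" and q: "q \<le> card P'"
      and le: "card L + 2 * k + 3 * q \<le> card W + card ?A" for k q
  proof -
    have "card (L' \<union> P) = card L' + card P"
      by (rule card_Un_disjoint; auto simp: defs)
    with k obtain K where K: "K \<subseteq> L' \<union> P" "card K = k"
      by (metis obtain_subset_with_card_n)
    from q obtain Q where Q: "Q \<subseteq> P'" "card Q = q"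
      by (metis obtain_subset_with_card_n)
    have sub: "L \<union> K \<union> Q \<subseteq> verts G" and finK: "finite K" "finite Q"
      using K Q by (auto simp: defs W_def intro: finite_subset)
    have "L \<inter> (L' \<union> P) = {}" "L \<inter> P' = {}" "(L' \<union> P) \<inter> P' = {}"
      by (auto simp: defs)
    then have disj: "L \<inter> K = {}" "L \<inter> Q = {}" "K \<inter> Q = {}"
      using K Q by blast+
    have deg: "out_degree G v \<le> c v + 1 + (if v \<in> ?A then 1 else 0)" if "v \<in> W" for v
      using that out_degree_le by (simp add: W_def c_def)
    have "out_degree G v \<le> 1" if "v \<in> L" for v
      using deg[of v] that by (auto simp: defs)
    then have "(\<Sum>v\<in>L. out_degree G v) \<le> card L"
      using sum_bounded_above[of L "out_degree G" 1] by simp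
    moreover have "out_degree G v \<le> 2" if "v \<in> K" for v
      using deg[of v] that K by (auto simp: defs)
    then have "(\<Sum>v\<in>K. out_degree G v) \<le> k * 2"
      using sum_bounded_above[of K "out_degree G" 2] K by simp
    moreover have "out_degree G v \<le> 3" if "v \<in> Q" for v
      using deg[of v] that Q by (auto simp: defs)
    then have "(\<Sum>v\<in>Q. out_degree G v) \<le> q * 3"
      using sum_bounded_above[of Q "out_degree G" 3] Q by simp
    moreover have "(\<Sum>v\<in>L \<union> K \<union> Q. out_degree G v)
      = (\<Sum>v\<in>L. out_degree G v) + (\<Sum>v\<in>K. out_degree G v) + (\<Sum>v\<in>Q. out_degree G v)"
      using disj finK by (simp add: sum.union_disjoint Int_Un_distrib2)
    ultimately have "(\<Sum>v\<in>L \<union> K \<union> Q. out_degree G v) \<le> card (edges G)"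
      using le card_edges_ge by (simp add: W_def)
    then have "card (L \<union> K \<union> Q) \<le> ?a"
      using sub by (intro card_le_annihilation_number) auto
    then show ?thesis
      using card_Un3[of L K Q] disj finK K Q by simp
  qed
  have g2: "2 * ?g \<le> card W + card L + card L' + 2"
  proof -
    obtain D where "total_dominating_set G D" "2 * card D \<le> card (verts G) + card childless + 1"
      by (rule total_dominating_set_mod_4)
    then show ?thesis
      using total_domination_number_le_card[of G D] card_C card_V by linarith
  qed
  have g3: "3 * ?g \<le> 2 * card W + 4"
  proof -
    obtain D where "total_dominating_set G D" "3 * card D \<le> 2 * card (verts G) + 2"
      by (rule total_dominating_set_mod_3)
    then show ?thesis
      using total_domination_number_le_card[of G D] card_V by linarith
  qed
  have g1: "?g + card L + card L' \<le> card W + 2"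
  proof -
    obtain D where "total_dominating_set G D" "card D + card childless \<le> card (verts G) + 1"
      by (rule total_dominating_set_nonchildless)
    then show ?thesis
      using total_domination_number_le_card[of G D] card_C card_V by linarith
  qed
  \<comment> \<open>This lower bound for the number of edges serves as the budget.\<close>
  let ?m = "card W + card ?A"
  show ?thesis
  proof (cases "(?m - card L) div 2 \<le> card L' + card P")
    case True
    define k where "k = (?m - card L) div 2"
    have "card L \<le> ?m"
      using card_W by simp
    then have k: "2 * k + card L \<le> ?m" "?m \<le> 2 * k + card L + 1"
      unfolding k_def by linarith+
    then have "card L + k \<le> ?a"
      using ann[of k 0] True by (simp add: k_def)
    moreover have "2 * ?g \<le> ?m + card L + 2"
      using g2 card_A by linarith
    ultimately show ?thesis
      using k(2) by linarith
  next
    case False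
    have half: "2 * j \<le> i" if "\<not> i div 2 \<le> j" for i j :: nat
      using that by linarith
    \<comment> \<open>\<open>b\<close> is what remains of the budget after all vertices of degree 1 and 2.\<close>
    define b where "b = ?m - card L - 2 * (card L' + card P)"
    define q where "q = min (card P') (b div 3)"
    have "2 * (card L' + card P) \<le> ?m - card L"
      using half[OF False] .
    moreover have "card L \<le> ?m"
      using card_W by simp
    ultimately have b: "b + card L + 2 * card L' + 2 * card P = ?m"
      unfolding b_def by simp
    have q: "q \<le> card P'" "3 * q \<le> b"
      unfolding q_def by auto
    have a: "card L + (card L' + card P) + q \<le> ?a"
      using q b by (intro ann) auto
    show ?thesis
    proof (cases "q = card P'")
      case True
      then show ?thesis
        using a g1 card_W leaves_ge by linarith
    next
      case False
      then have "b \<le> 3 * q + 2"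
        unfolding q_def by linarith
      \<comment> \<open>As \<open>5 = 3 + 2\<close>, the surplus of 2 left by the roundings is lost when dividing by 3.\<close>
      then have "3 * ?g \<le> 3 * ?a + 5"
        using a g3 b card_W card_A leaves_ge by linarith
      then show ?thesis by linarith
    qed
  qed
qed

end

section \<open>Rooting an acyclic graph\<close>

lemma (in wf_digraph) adj_del_vertI:
  assumes "u \<rightarrow> w" "u \<noteq> v" "w \<noteq> v"
  shows "u \<rightarrow>\<^bsub>del_vert v\<^esub> w"
  using assms by (auto simp: arcs_ends_conv del_vert_simps image_iff)

context graph
begin

lemma graph_del_vert: "graph (del_vert v)"
proof -
  interpret H: fin_digraph "del_vert v"
    by (rule fin_digraph_del_vert)
  have "symmetric (del_vert v)"
    using sym_arcs by (fastforce simp: symmetric_conv del_vert_simps)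
  then show ?thesis
    by unfold_locales
      (auto simp: del_vert_simps ends_del_vert dest: no_loops intro: no_multi_arcs)
qed

text \<open>
  A path from \<open>u\<close> to \<open>u'\<close> that avoids \<open>v\<close> closes up to a cycle through \<open>v\<close>. As \<open>u \<noteq> u'\<close>, the path has at
  least one arc, so the cycle has length at least 3 and does not merely traverse one edge back and
  forth.
\<close>

lemma neighbours_separated_if_acyclic:
  assumes acyclic: "\<nexists>p. undirected_cycle G p"
    and adj: "v \<rightarrow> u" "v \<rightarrow> u'" and neq: "u \<noteq> u'"
  shows "\<not> u \<rightarrow>\<^sup>*\<^bsub>del_vert v\<^esub> u'"
proof
  assume reach: "u \<rightarrow>\<^sup>*\<^bsub>del_vert v\<^esub> u'"
  interpret H: wf_digraph "del_vert v"
    by (rule wf_digraph_del_vert)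
  obtain q where q: "H.apath u q u'"
    using reach H.reachable_apath by blast
  have verts_eq: "H.awalk_verts = awalk_verts"
    using subgraph_del_vert[of v] by (metis compatible_awalk_verts subgraphE)
  have walk: "awalk u q u'"
    using q subgraph_awalk_imp_awalk[OF _ subgraph_del_vert] by (auto simp: H.apath_def)
  have dist: "distinct (awalk_verts u q)"
    using q by (simp add: H.apath_def verts_eq)
  have "set (awalk_verts u q) \<subseteq> verts (del_vert v)"
    using q verts_eq by (metis H.apath_def H.awalkE')
  then have v: "v \<notin> set (awalk_verts u q)"
    by (auto simp: del_vert_simps)
  obtain e where e: "e \<in> arcs G" "tail G e = v" "head G e = u"
    using adj(1) by (rule reachableE)
  obtain f where f: "f \<in> arcs G" "tail G f = u'" "head G f = v"
    using arcs_ends_symmetric[OF sym_arcs adj(2)] by (rule reachableE)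
  have "awalk u' [f] v"
    using f by (auto simp: awalk_simps)
  with walk have walk': "awalk u (q @ [f]) v"
    by (rule awalk_appendI)
  then have "awalk v (e # q @ [f]) v"
    using e by (auto simp: awalk_Cons_iff)
  moreover have "awalk_verts u (q @ [f]) = awalk_verts u q @ [v]"
    using awalk_verts_append[OF walk'] f by simp
  then have "distinct (tl (awalk_verts v (e # q @ [f])))"
    using dist v e by simp
  moreover have "q \<noteq> []"
    using walk neq by (auto simp: awalk_Nil_iff)
  then have "3 \<le> length (e # q @ [f])"
    by (cases q) auto
  ultimately have "undirected_cycle G (e # q @ [f])"
    unfolding undirected_cycle_def cycle_def by blast
  with acyclic show False by blast
qed

text \<open>
  The depth is the distance from \<open>y\<close>. A vertex \<open>v\<close> has at most one neighbour that is not farther from \<open>y\<close>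
  than \<open>v\<close> itself, because two of them would both be connected to \<open>y\<close> by shortest walks avoiding \<open>v\<close>.
  Hence the parent is unique and every edge joins a vertex to its parent.
\<close>

lemma undirected_tree_parent_function:
  assumes tree: "undirected_tree G" and y: "y \<in> verts G"
  obtains par dep where "dep y = (0::nat)"
    "\<And>v. v \<in> verts G \<Longrightarrow> v \<noteq> y \<Longrightarrow> par v \<in> verts G \<and> v \<rightarrow> par v \<and> dep v = Suc (dep (par v))"
    "\<And>u v. u \<rightarrow> v \<Longrightarrow> v \<noteq> y \<and> par v = u \<or> u \<noteq> y \<and> par u = v"
proof -
  let ?E = "arcs_ends G"
  define dep where "dep v = (LEAST k. (y, v) \<in> ?E ^^ k)" for v
  have acyclic: "\<nexists>p. undirected_cycle G p" and conn: "strongly_connected G"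
    using tree symmetric_connected_imp_strongly_connected[OF sym_arcs]
    by (auto simp: undirected_tree_def)
  have dep_le: "dep v \<le> k" if "(y, v) \<in> ?E ^^ k" for v k
    unfolding dep_def using that by (rule Least_le)
  have dep_walk: "(y, v) \<in> ?E ^^ dep v" if "v \<in> verts G" for v
  proof -
    have "(y, v) \<in> ?E\<^sup>*"
      using conn y that by (auto simp: strongly_connected_def intro: reachable_rtranclI)
    then obtain k where "(y, v) \<in> ?E ^^ k"
      by (auto simp: rtrancl_power)
    then show ?thesis
      unfolding dep_def by (rule LeastI)
  qed
  have dep_y: "dep y = 0"
    using dep_le[of y 0] by simp
  define par where "par v = (SOME u. v \<rightarrow> u \<and> dep v = Suc (dep u))" for v
  have par: "v \<rightarrow> par v \<and> dep v = Suc (dep (par v))" if v: "v \<in> verts G" "v \<noteq> y" for v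
  proof -
    obtain k where k: "dep v = Suc k"
      using dep_walk[OF v(1)] v(2) by (cases "dep v") auto
    then obtain u where u: "(y, u) \<in> ?E ^^ k" "u \<rightarrow> v"
      using dep_walk[OF v(1)] by auto
    have "u \<in> verts G"
      using u adj_in_verts by blast
    then have "(y, v) \<in> ?E ^^ Suc (dep u)"
      using dep_walk u(2) by auto
    then have "dep u = k"
      using dep_le[OF u(1)] dep_le k by fastforce
    then have "v \<rightarrow> u \<and> dep v = Suc (dep u)"
      using u k arcs_ends_symmetric[OF sym_arcs] by auto
    then show ?thesis
      unfolding par_def by (rule someI)
  qed
  have reach: "y \<rightarrow>\<^sup>*\<^bsub>del_vert v\<^esub> u" if "u \<in> verts G" "u \<noteq> v" "dep u \<le> dep v" for u v
    using that
  proof (induction "dep u" arbitrary: u)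
    case 0
    then have "u = y"
      using par by fastforce
    with 0 y show ?case
      by (simp add: del_vert_simps wf_digraph.reachable_refl[OF wf_digraph_del_vert])
  next
    case (Suc k)
    then have "u \<noteq> y"
      using dep_y by auto
    then have p: "u \<rightarrow> par u" "dep u = Suc (dep (par u))"
      using par Suc.prems by auto
    then have "par u \<noteq> v"
      using Suc.prems by auto
    moreover have "par u \<in> verts G"
      using p adj_in_verts by blast
    ultimately have "y \<rightarrow>\<^sup>*\<^bsub>del_vert v\<^esub> par u"
      using Suc p by auto
    moreover have "par u \<rightarrow>\<^bsub>del_vert v\<^esub> u"
      using p Suc.prems \<open>par u \<noteq> v\<close> arcs_ends_symmetric[OF sym_arcs] by (intro adj_del_vertI) auto
    ultimately show ?case
      by (rule wf_digraph.reachable_adj_trans[OF wf_digraph_del_vert])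
  qed
  have tree_edge: "v \<noteq> y \<and> par v = u" if vu: "v \<rightarrow> u" and le: "dep u \<le> dep v" for u v
  proof -
    have in_verts: "u \<in> verts G" "v \<in> verts G"
      using vu adj_in_verts by blast+
    have "u \<noteq> v"
      using vu adj_not_same by blast
    have "v \<noteq> y"
      using le dep_y \<open>u \<noteq> v\<close> par[OF in_verts(1)] by auto
    then have p: "v \<rightarrow> par v" "dep v = Suc (dep (par v))"
      using par in_verts by auto
    then have "par v \<noteq> v" "par v \<in> verts G"
      using adj_not_same adj_in_verts by auto
    then have "y \<rightarrow>\<^sup>*\<^bsub>del_vert v\<^esub> par v"
      using p by (intro reach) auto
    moreover have "y \<rightarrow>\<^sup>*\<^bsub>del_vert v\<^esub> u"
      using in_verts \<open>u \<noteq> v\<close> le by (intro reach) auto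
    ultimately have "u \<rightarrow>\<^sup>*\<^bsub>del_vert v\<^esub> par v"
      using graph_del_vert[of v]
      by (meson graph_def pseudo_graph_def sym_digraph.symmetric_reachable' wf_digraph.reachable_trans
          wf_digraph_del_vert)
    then show ?thesis
      using neighbours_separated_if_acyclic[OF acyclic vu p(1)] \<open>v \<noteq> y\<close> by blast
  qed
  show ?thesis
  proof (rule that[of dep par])
    fix u v assume "u \<rightarrow> v"
    then show "v \<noteq> y \<and> par v = u \<or> u \<noteq> y \<and> par u = v"
      using tree_edge arcs_ends_symmetric[OF sym_arcs] by (metis linear)
  qed (use dep_y par adj_in_verts in blast)+
qed

end

theorem theorem1p2:
  fixes G :: "('a, 'b) pre_digraph"
  assumes "graph G"
    and "nontrivial_quasi_tree G"
  shows "total_domination_number G \<le> annihilation_number G + 1"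
proof -
  interpret graph G by fact
  obtain x where conn: "connected G" and x: "x \<in> verts G" and tree: "undirected_tree (del_vert x)"
    using assms(2) by (auto simp: nontrivial_quasi_tree_def quasi_tree_def)
  interpret H: graph "del_vert x"
    by (rule graph_del_vert)
  obtain z where z: "z \<in> verts G" "z \<noteq> x"
    using tree by (auto simp: undirected_tree_def connected_conv del_vert_simps)
  have "x \<rightarrow>\<^sup>*\<^bsub>G\<^esub> z"
    using symmetric_connected_imp_strongly_connected[OF sym_arcs conn] x z
    by (auto simp: strongly_connected_def)
  then obtain y where xy: "x \<rightarrow>\<^bsub>G\<^esub> y"
    using z by (cases rule: converse_reachable_cases) auto
  then have y: "y \<in> verts G" "y \<noteq> x"
    using adj_in_verts adj_not_same by blast+
  then have y': "y \<in> verts (del_vert x)"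
    by (simp add: del_vert_simps)
  obtain par dep where dep_y: "dep y = (0::nat)"
    and par: "\<And>v. v \<in> verts (del_vert x) \<Longrightarrow> v \<noteq> y \<Longrightarrow>
      par v \<in> verts (del_vert x) \<and> v \<rightarrow>\<^bsub>del_vert x\<^esub> par v \<and> dep v = Suc (dep (par v))"
    and edge: "\<And>u v. u \<rightarrow>\<^bsub>del_vert x\<^esub> v \<Longrightarrow> v \<noteq> y \<and> par v = u \<or> u \<noteq> y \<and> par u = v"
    by (rule H.undirected_tree_parent_function[OF tree y']) (rule that; assumption)
  have adj_mono: "u \<rightarrow>\<^bsub>G\<^esub> v" if "u \<rightarrow>\<^bsub>del_vert x\<^esub> v" for u v
    using that by (auto simp: arcs_ends_conv del_vert_simps)
  \<comment> \<open>Hanging \<open>y\<close> below \<open>x\<close> moves all other vertices one level down.\<close>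
  let ?par = "par(y := x)" and ?dep = "\<lambda>v. if v = x then 0 else Suc (dep v)"
  interpret apex_tree G x ?par ?dep
  proof
    fix v assume v: "v \<in> verts G" "v \<noteq> x"
    show "?par v \<in> verts G" "v \<rightarrow>\<^bsub>G\<^esub> ?par v" "?dep v = Suc (?dep (?par v))"
      using v x par[of v] dep_y adj_mono arcs_ends_symmetric[OF sym_arcs xy]
      by (auto simp: del_vert_simps)
  next
    fix u v assume "u \<rightarrow>\<^bsub>G\<^esub> v" "u \<noteq> x" "v \<noteq> x"
    then show "?par u = v \<or> ?par v = u"
      using edge[of u v] adj_del_vertI by auto
  qed (use x y in auto)
  show ?thesis
    by (rule total_domination_number_le_annihilation_number)
qed

end
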